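(* Let $n$ be a positive even integer. For a function $b:\{0,1\}^n\to\{0,1\}$ define the coloring $c_b$ of the vertices of the Grassmann graph $J_2(n,2)$ by $c_b(W)=|\{x\in W: b(x)=1\}|$. Then $b\mapsto c_b$ is a one-to-one correspondence between the Boolean bent functions $b$ with $|\{x:b(x)=1\}|=2^{n-1}+2^{n/2-1}$ and $b(\bar 0)=1$, and the perfect colorings of $J_2(n,2)$ with colors $1,2,3,4$ and quotient matrix $$\begin{pmatrix} 3(2^{n-3}-2^{\frac{n}{2}-2}-1)& 3\cdot2^{n-2}-3 & 3(2^{n-3}+2^{\frac{n}{2}-2}) & 0\\ 2^{n-2}-2^{\frac{n}{2}-1} & 5\cdot2^{n-3}-2^{\frac{n}{2}-2}-5& 2^{n-1}+2^{\frac{n}{2}-1} & 2^{n-3}+2^{\frac{n}{2}-2}-1\\ 2^{n-3}-2^{\frac{n}{2}-2} & 2^{n-1}-2^{\frac{n}{2}-1}-1 & 5\cdot2^{n-3}+2^{\frac{n}{2}-2}-3 & 2^{n-2}+2^{\frac{n}{2}-1}-2 \\ 0 & 3(2^{n-3}-2^{\frac{n}{2}-2}) & 3\cdot2^{n-2} & 3(2^{n-3}+2^{\frac{n}{2}-2}-2) \end{pmatrix},$$ whose $i$-th row and column correspond to color $i$.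
   Context: Identify $\{0,1\}^n$ with the vector space $\mathrm{GF}(2)^n$. The Grassmann graph $J_2(n,2)$ has as vertices the $2$-dimensional subspaces of $\mathrm{GF}(2)^n$, two being adjacent iff their intersection is $1$-dimensional. A Boolean bent function is a function $b:\{0,1\}^n\to\{0,1\}$ such that $\sum_{x\in\{0,1\}^n}(-1)^{b(x)+b(x+y)}=0$ for every nonzero $y$ (equivalently the convolution $(-1)^b*(-1)^b$ equals $2^n$ at $\bar 0$ and $0$ elsewhere). A coloring $f$ of a graph is perfect with quotient matrix $S=(s_{ij})$ if every vertex of color $i$ has exactly $s_{ij}$ neighbors of color $j$, for all colors $i,j$.
   Formalization: For n=2 the claim fails: the graph has one vertex, and the three bent functions of weight 3 with b(0)=1 all give the same perfect coloring (constant 3). The formal theorem asserts the bijection for even n≥4, and for n=2 only that the image is exactly the set of perfect colorings. *)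

theory Defs
  imports "HOL-Analysis.Analysis" "HOL-Library.Z2"
begin

text \<open>The space \<open>GF(2)\<^sup>n\<close> is \<^typ>\<open>bit ^ 'n\<close> with \<open>n = CARD('n)\<close>; \<open>vec.subspace\<close> and
  \<open>vec.dim\<close> are linear algebra over the field \<^typ>\<open>bit\<close>. Values of Boolean functions are
  the natural numbers 0 and 1, so that they can be used as exponents.\<close>

definition grassmann_vertices :: "(bit ^ 'n) set set" where
  "grassmann_vertices = {W. vec.subspace W \<and> vec.dim W = 2}"

definition grassmann_adj :: "(bit ^ 'n) set \<Rightarrow> (bit ^ 'n) set \<Rightarrow> bool" where
  "grassmann_adj U W \<longleftrightarrow> vec.dim (U \<inter> W) = 1"

definition boolean_bent :: "(bit ^ 'n \<Rightarrow> nat) \<Rightarrow> bool" where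
  "boolean_bent b \<longleftrightarrow>
     (\<forall>x. b x \<in> {0, 1}) \<and>
     (\<forall>y. y \<noteq> 0 \<longrightarrow> (\<Sum>x\<in>UNIV. (-1 :: int) ^ (b x + b (x + y))) = 0)"

text \<open>Colorings are extensional functions on the vertex set \<open>V\<close>, so that two colorings are equal
  iff they agree on \<open>V\<close>. Not every color in \<open>C\<close> is required to occur.\<close>

definition perfect_coloring ::
  "'v set \<Rightarrow> ('v \<Rightarrow> 'v \<Rightarrow> bool) \<Rightarrow> 'c set \<Rightarrow> ('c \<Rightarrow> 'c \<Rightarrow> real) \<Rightarrow> ('v \<Rightarrow> 'c) \<Rightarrow> bool" where
  "perfect_coloring V adj C S f \<longleftrightarrow>
     f \<in> V \<rightarrow>\<^sub>E C \<and>
     (\<forall>v\<in>V. \<forall>j\<in>C. real (card {w \<in> V. adj v w \<and> f w = j}) = S (f v) j)"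

definition bent_coloring :: "(bit ^ 'n \<Rightarrow> nat) \<Rightarrow> (bit ^ 'n) set \<Rightarrow> nat" where
  "bent_coloring b = (\<lambda>W\<in>grassmann_vertices. card {x \<in> W. b x = 1})"

text \<open>\<open>p k\<close> is \<open>2\<close> to the integer power \<open>k\<close>, so no exponent is truncated at 0. Rows and
  columns are numbered from 1.\<close>

definition quotient_matrix :: "nat \<Rightarrow> nat \<Rightarrow> nat \<Rightarrow> real" where
  "quotient_matrix n i j =
     (let p = (\<lambda>k::int. (2::real) powi k); m = int n; h = int (n div 2) in
      [[3 * (p (m - 3) - p (h - 2) - 1), 3 * p (m - 2) - 3,
        3 * (p (m - 3) + p (h - 2)), 0],
       [p (m - 2) - p (h - 1), 5 * p (m - 3) - p (h - 2) - 5,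
        p (m - 1) + p (h - 1), p (m - 3) + p (h - 2) - 1],
       [p (m - 3) - p (h - 2), p (m - 1) - p (h - 1) - 1,
        5 * p (m - 3) + p (h - 2) - 3, p (m - 2) + p (h - 1) - 2],
       [0, 3 * (p (m - 3) - p (h - 2)),
        3 * p (m - 2), 3 * (p (m - 3) + p (h - 2) - 2)]] ! (i - 1) ! (j - 1))"

definition bent_class :: "(bit ^ 'n \<Rightarrow> nat) set" where
  "bent_class =
     {b. boolean_bent b \<and>
         card {x. b x = 1} = 2 ^ (CARD('n) - 1) + 2 ^ (CARD('n) div 2 - 1) \<and> b 0 = 1}"

definition coloring_class :: "((bit ^ 'n) set \<Rightarrow> nat) set" where
  "coloring_class =
     {f. perfect_coloring grassmann_vertices grassmann_adj {1, 2, 3, 4}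
           (quotient_matrix CARD('n)) f}"

end

theory Submission
  imports Defs
begin

text \<open>For a nonzero point \<open>w\<close> let \<open>n\<^sub>j(w)\<close> be the number of vertices (lines) of color \<open>j\<close> containing
  \<open>w\<close>. A line \<open>W\<close> has \<open>\<Sum>n\<^sub>j(w) - 3[c(W) = j]\<close> neighbours of color \<open>j\<close>, summed over the three
  nonzero points of \<open>W\<close>, and row \<open>i\<close> of \<open>S + 3I\<close> is \<open>(4 - i) r\<^sub>0 + (i - 1) r\<^sub>1\<close> for two fixed rows
  \<open>r\<^sub>0, r\<^sub>1\<close>. Counting the pairs \<open>{x, x + w}\<close> by their values shows that \<open>b\<close> is bent of the given weight iff
  \<open>n\<^sub>j(w) = r\<^sub>0(j)\<close> for \<open>b(w) = 0\<close> and \<open>n\<^sub>j(w) = r\<^sub>1(j)\<close> for \<open>b(w) = 1\<close>, so bent functions give perfect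
  colorings. Conversely, a function on points is determined by its sums over lines when \<open>n \<ge> 3\<close>, hence
  a perfect coloring satisfies \<open>n\<^sub>j = r\<^sub>0(j) + g (r\<^sub>1(j) - r\<^sub>0(j))\<close> with \<open>g = 1 - n\<^sub>1 / r\<^sub>0(1)\<close>.
  Since \<open>r\<^sub>0(4) = 0\<close>, \<open>g \<ge> 0\<close>; and if \<open>n\<^sub>1(w) > 0\<close>, then \<open>w\<close> lies on a line of color 1, on which \<open>g\<close>
  sums to 0, so \<open>g(w) = 0\<close>. So \<open>g\<close> takes only the values 0 and 1, and it is the required bent function.\<close>

section \<open>Lines over the two-element field\<close>

lemma UNIV_bit: "(UNIV :: bit set) = {0, 1}"
  using bit_not_zero_iff by blast

instance bit :: finite
  by standard (metis UNIV_bit finite.emptyI finite_insert)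

lemma card_bit [simp]: "CARD(bit) = 2"
  unfolding UNIV_bit by (simp add: card_insert_if)

lemma bit_add_self [simp]: "(a :: bit) + a = 0"
  by (cases a) simp_all

lemma vec_add_self [simp]: "(x :: bit ^ 'n) + x = 0"
  by (simp add: vec_eq_iff)

lemma vec_add_self_left [simp]: "(x :: bit ^ 'n) + (x + y) = y"
  by (simp add: vec_eq_iff flip: add.assoc)

lemma vec_double [simp]: "2 * (x :: bit ^ 'n) = 0"
  by (simp only: mult_2 vec_add_self)

lemma vec_minus [simp]: "(x :: bit ^ 'n) - y = x + y"
  by (simp add: vec_eq_iff)

lemma vec_add_self_right [simp]: "(y :: bit ^ 'n) + x + x = y"
  by (simp add: add.assoc)

lemma vec_add_eq_0_iff [simp]: "(x :: bit ^ 'n) + y = 0 \<longleftrightarrow> x = y"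
  by (metis vec_add_self_left vec_add_self add.right_neutral)

text \<open>Resolves the scalar quantifier that \<open>vec.span_breakdown_eq\<close>
  introduces.\<close>

lemma ex_bit: "(\<exists>k :: bit. P k) \<longleftrightarrow> P 0 \<or> P 1"
  by (metis bit_not_zero_iff)

section \<open>Two-dimensional subspaces as four-element sets\<close>

definition line :: "bit ^ 'n \<Rightarrow> bit ^ 'n \<Rightarrow> (bit ^ 'n) set" where
  "line w x = {0, w, x, x + w}"

lemma span_singleton_bit: "vec.span {x :: bit ^ 'n} = {0, x}"
  by (auto simp: vec.span_breakdown_eq ex_bit)

lemma span_pair_bit: "vec.span {w, x :: bit ^ 'n} = line w x"
  by (auto simp: vec.span_breakdown_eq ex_bit line_def span_singleton_bit add.commute)

lemma independent_pair_bit: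
  "w \<noteq> 0 \<Longrightarrow> x \<noteq> 0 \<Longrightarrow> x \<noteq> w \<Longrightarrow> vec.independent {w, x :: bit ^ 'n}"
  by (auto simp: vec.independent_insert span_singleton_bit)

text \<open>Over GF(2) a pair is independent as soon as its members are nonzero and distinct, and
  its span consists of its four subset sums.\<close>

lemma grassmann_vertices_eq:
  "grassmann_vertices = {line w x | w x :: bit ^ 'n. w \<noteq> 0 \<and> x \<noteq> 0 \<and> x \<noteq> w}" (is "_ = ?R")
proof (intro equalityI subsetI)
  fix W :: "(bit ^ 'n) set"
  assume "W \<in> grassmann_vertices"
  then have W: "vec.subspace W" "vec.dim W = 2"
    by (auto simp: grassmann_vertices_def)
  obtain B where B: "B \<subseteq> W" "vec.independent B" "W \<subseteq> vec.span B" "card B = 2"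
    using vec.basis_exists[of W] W by metis
  obtain w x where wx: "B = {w, x}" "w \<noteq> x"
    using B by (meson card_2_iff)
  have "w \<noteq> 0" "x \<noteq> 0"
    using B(2) wx vec.dependent_zero by auto
  moreover have "W = line w x"
    using B W(1) vec.span_minimal[of B W] by (auto simp: wx span_pair_bit)
  ultimately show "W \<in> ?R"
    using wx by blast
next
  fix W assume "W \<in> ?R"
  then obtain w x where W: "W = line w x" "w \<noteq> 0" "x \<noteq> 0" "x \<noteq> w"
    by blast
  have "vec.dim (vec.span {w, x}) = card {w, x}"
    unfolding vec.dim_span
    by (rule vec.dim_eq_card_independent) (use W independent_pair_bit in auto)
  then show "W \<in> grassmann_vertices"
    using W by (auto simp: grassmann_vertices_def simp flip: span_pair_bit)
qed

lemma line_in_vertices [intro]: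
  "w \<noteq> 0 \<Longrightarrow> x \<noteq> 0 \<Longrightarrow> x \<noteq> w \<Longrightarrow> line w (x :: bit ^ 'n) \<in> grassmann_vertices"
  by (auto simp: grassmann_vertices_eq)

lemma card_line: "w \<noteq> 0 \<Longrightarrow> x \<noteq> 0 \<Longrightarrow> x \<noteq> w \<Longrightarrow> card (line w (x :: bit ^ 'n)) = 4"
  by (auto simp: line_def card_insert_if)

lemma vertex_card: "W \<in> grassmann_vertices \<Longrightarrow> card (W :: (bit ^ 'n) set) = 4"
  by (auto simp: grassmann_vertices_eq card_line)

lemma vertex_subspace: "W \<in> grassmann_vertices \<Longrightarrow> vec.subspace (W :: (bit ^ 'n) set)"
  by (auto simp: grassmann_vertices_def)

lemma vertex_zero: "W \<in> grassmann_vertices \<Longrightarrow> (0 :: bit ^ 'n) \<in> W"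
  by (simp add: vertex_subspace vec.subspace_0)

lemma vertex_eq_line:
  assumes "W \<in> grassmann_vertices" "(w :: bit ^ 'n) \<in> W" "x \<in> W" "w \<noteq> 0" "x \<noteq> 0" "x \<noteq> w"
  shows "W = line w x"
proof (rule sym, rule card_subset_eq)
  show "line w x \<subseteq> W"
    using assms vertex_subspace[OF assms(1)]
    by (auto simp: line_def intro: vec.subspace_0 vec.subspace_add)
qed (use assms in \<open>auto simp: vertex_card card_line\<close>)

lemma vertex_unique:
  assumes "U \<in> grassmann_vertices" "W \<in> grassmann_vertices"
    and "(w :: bit ^ 'n) \<in> U \<inter> W" "x \<in> U \<inter> W" "w \<noteq> 0" "x \<noteq> 0" "x \<noteq> w"
  shows "U = W"
  by (rule trans[OF vertex_eq_line[of U w x] vertex_eq_line[of W w x, symmetric]]) (use assms in auto)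

section \<open>Adjacency as incidence\<close>

lemma dim_one_iff:
  assumes "vec.subspace (S :: (bit ^ 'n) set)"
  shows "vec.dim S = 1 \<longleftrightarrow> (\<exists>w. w \<noteq> 0 \<and> S = {0, w})"
proof
  assume dim: "vec.dim S = 1"
  obtain B where B: "B \<subseteq> S" "vec.independent B" "S \<subseteq> vec.span B" "card B = 1"
    using vec.basis_exists[of S] dim by metis
  obtain w where w: "B = {w}"
    using B by (meson card_1_singletonE)
  have "S = {0, w}"
    using B assms vec.span_minimal[of B S] by (auto simp: w span_singleton_bit)
  moreover have "w \<noteq> 0"
    using B w by auto
  ultimately show "\<exists>w. w \<noteq> 0 \<and> S = {0, w}"
    by blast
next
  assume "\<exists>w. w \<noteq> 0 \<and> S = {0, w}"
  then obtain w where w: "w \<noteq> 0" "S = vec.span {w}"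
    by (auto simp: span_singleton_bit)
  have "vec.dim {w} = card {w}"
    by (rule vec.dim_eq_card_independent) (use w in auto)
  then show "vec.dim S = 1"
    by (simp add: w)
qed

text \<open>Two distinct nonzero vectors determine the vertex containing them, so distinct vertices
  share at most one nonzero vector. This removes dimension from all later counting.\<close>

lemma grassmann_adj_iff:
  assumes "U \<in> grassmann_vertices" "W \<in> grassmann_vertices"
  shows "grassmann_adj U W \<longleftrightarrow> U \<noteq> W \<and> (\<exists>w :: bit ^ 'n. w \<noteq> 0 \<and> w \<in> U \<and> w \<in> W)"
proof -
  have "vec.subspace (U \<inter> W)"
    using assms vertex_subspace vec.subspace_inter by blast
  then have "grassmann_adj U W \<longleftrightarrow> (\<exists>w. w \<noteq> 0 \<and> U \<inter> W = {0, w})"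
    unfolding grassmann_adj_def by (rule dim_one_iff)
  also have "\<dots> \<longleftrightarrow> U \<noteq> W \<and> (\<exists>w. w \<noteq> 0 \<and> w \<in> U \<and> w \<in> W)" (is "?L \<longleftrightarrow> ?R")
  proof
    assume ?L
    then obtain w where w: "w \<noteq> 0" "U \<inter> W = {0, w}"
      by blast
    then have "card (U \<inter> W) = 2"
      by simp
    then have "U \<noteq> W"
      using assms vertex_card[of U] by auto
    then show ?R
      using w by blast
  next
    assume R: ?R
    then obtain w where w: "w \<noteq> 0" "w \<in> U" "w \<in> W"
      by blast
    have "x = 0 \<or> x = w" if x: "x \<in> U" "x \<in> W" for x
    proof (rule ccontr)
      assume "\<not> (x = 0 \<or> x = w)"
      then have "U = W"
        using w x assms by (intro vertex_unique[of U W w x]) auto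
      then show False
        using R by simp
    qed
    then have "U \<inter> W = {0, w}"
      using w assms vertex_zero by auto
    then show ?L
      using w by blast
  qed
  finally show ?thesis .
qed

section \<open>Sums over the lines through a point\<close>

definition lines_through :: "bit ^ 'n \<Rightarrow> (bit ^ 'n) set set" where
  "lines_through w = {W \<in> grassmann_vertices. w \<in> W}"

definition color_count :: "((bit ^ 'n) set \<Rightarrow> nat) \<Rightarrow> bit ^ 'n \<Rightarrow> nat \<Rightarrow> nat" where
  "color_count f w j = card {W \<in> lines_through w. f W = j}"

text \<open>Double counting: each \<open>x\<close> outside \<open>{0, w}\<close> lies on exactly one
  line through \<open>w\<close>, and each such line contains exactly two of these
  \<open>x\<close>.\<close>

lemma sum_lines_through:
  fixes w :: "bit ^ 'n" and \<phi> :: "_ \<Rightarrow> 'a :: comm_semiring_1"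
  assumes "w \<noteq> 0"
  shows "(\<Sum>x\<in>UNIV - {0, w}. \<phi> (line w x)) = 2 * (\<Sum>W\<in>lines_through w. \<phi> W)"
proof -
  have "(\<Sum>x\<in>UNIV - {0, w}. \<phi> (line w x)) =
      (\<Sum>x\<in>UNIV - {0, w}. \<Sum>W\<in>{W \<in> lines_through w. x \<in> W}. \<phi> W)"
  proof (intro sum.cong refl)
    fix x assume x: "x \<in> UNIV - {0, w}"
    have "W = line w x" if "W \<in> lines_through w" "x \<in> W" for W
      using that x assms by (intro vertex_eq_line) (auto simp: lines_through_def)
    moreover have "line w x \<in> lines_through w" "x \<in> line w x"
      using x assms line_in_vertices[of w x] by (auto simp: lines_through_def line_def)
    ultimately have "{W \<in> lines_through w. x \<in> W} = {line w x}"
      by blast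
    then show "\<phi> (line w x) = (\<Sum>W\<in>{W \<in> lines_through w. x \<in> W}. \<phi> W)"
      by simp
  qed
  also have "\<dots> = (\<Sum>W\<in>lines_through w. \<Sum>x\<in>{x \<in> UNIV - {0, w}. x \<in> W}. \<phi> W)"
    by (rule sum.swap_restrict) auto
  also have "\<dots> = (\<Sum>W\<in>lines_through w. 2 * \<phi> W)"
  proof (intro sum.cong refl)
    fix W assume W: "W \<in> lines_through w"
    have "{x \<in> UNIV - {0, w}. x \<in> W} = W - {0, w}"
      by auto
    moreover have "card (W - {0, w}) = 4 - 2"
      using W assms vertex_card[of W] vertex_zero[of W]
      by (subst card_Diff_subset) (auto simp: lines_through_def)
    ultimately show "(\<Sum>x\<in>{x \<in> UNIV - {0, w}. x \<in> W}. \<phi> W) = 2 * \<phi> W"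
      by simp
  qed
  finally show ?thesis
    by (simp add: sum_distrib_left)
qed

text \<open>Summing the line equations through \<open>w\<close> over all third points
  \<open>x\<close> gives (2^n - 4) h(w) = -2H, where H is the total over nonzero points. Hence
  \<open>h\<close> is constant off 0, and a single line forces 3 h(w) = 0.\<close>

lemma line_sum_injective:
  fixes h :: "bit ^ 'n \<Rightarrow> real"
  assumes n: "CARD('n) \<ge> 3"
    and lines: "\<And>W. W \<in> grassmann_vertices \<Longrightarrow> (\<Sum>w\<in>W - {0}. h w) = 0"
    and "w \<noteq> 0"
  shows "h w = 0"
proof -
  define H where "H = (\<Sum>x\<in>UNIV - {0}. h x)"
  have line: "h w + h x + h (x + w) = 0" if "w \<noteq> 0" "x \<noteq> 0" "x \<noteq> w" for w x
  proof -
    have "line w x - {0} = {w, x, x + w}"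
      using that by (auto simp: line_def)
    then show ?thesis
      using lines[OF line_in_vertices[OF that]] that by (simp add: add.assoc)
  qed
  \<comment> \<open>Makes the coefficient 2^n - 4 nonzero; it vanishes for n = 2.\<close>
  have pn: "(2::real) ^ CARD('n) \<ge> 2 ^ 3"
    using n by (intro power_increasing) auto
  have h: "(2 ^ CARD('n) - 4) * h w = - 2 * H" if w: "w \<noteq> 0" for w
  proof -
    have "bij_betw (\<lambda>x. x + w) (UNIV - {0, w}) (UNIV - {0, w})"
      by (rule bij_betwI[where g = "\<lambda>x. x + w"]) auto
    then have shift: "(\<Sum>x\<in>UNIV - {0, w}. h (x + w)) = (\<Sum>x\<in>UNIV - {0, w}. h x)"
      by (rule sum.reindex_bij_betw)
    have H: "(\<Sum>x\<in>UNIV - {0, w}. h x) = H - h w"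
    proof -
      have "H = h w + (\<Sum>x\<in>UNIV - {0} - {w}. h x)"
        unfolding H_def using w by (intro sum.remove) auto
      moreover have "UNIV - {0} - {w} = UNIV - {0, w}"
        by auto
      ultimately show ?thesis
        by simp
    qed
    have "card (UNIV - {0, w}) = 2 ^ CARD('n) - 2"
      using w by (subst card_Diff_subset) auto
    moreover have "(2::nat) ^ CARD('n) \<ge> 2 ^ 1"
      using n by (intro power_increasing) auto
    ultimately have "real (card (UNIV - {0, w})) = 2 ^ CARD('n) - 2"
      by simp
    moreover have "0 = (\<Sum>x\<in>UNIV - {0, w}. h w + h x + h (x + w))"
      using line[OF w] by simp
    then have "0 = real (card (UNIV - {0, w})) * h w + 2 * (H - h w)"
      unfolding sum.distrib shift H by simp
    ultimately show ?thesis
      by (simp add: left_diff_distrib)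
  qed
  have const: "h x = h w" if "x \<noteq> 0" for x
  proof -
    have "(2 ^ CARD('n) - 4) * h x = (2 ^ CARD('n) - 4) * h w"
      using h that \<open>w \<noteq> 0\<close> by simp
    then show ?thesis
      using pn by simp
  qed
  have "card {0, w} < CARD(bit ^ 'n)"
  proof -
    have "2 ^ 3 \<le> (2::nat) ^ CARD('n)"
      using n by (intro power_increasing) auto
    then show ?thesis
      using \<open>w \<noteq> 0\<close> by simp
  qed
  then have "{0, w} \<noteq> UNIV"
    by (metis less_irrefl)
  then obtain x where x: "x \<noteq> 0" "x \<noteq> w"
    by blast
  then have "x + w \<noteq> 0"
    by simp
  have "h w + h x + h (x + w) = 0"
    using line[OF \<open>w \<noteq> 0\<close>] x by blast
  then show ?thesis
    unfolding const[OF x(1)] const[OF \<open>x + w \<noteq> 0\<close>] by simp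
qed

section \<open>Neighbours and lines through a point\<close>

lemma card_vertex_Diff_zero:
  assumes "W \<in> grassmann_vertices"
  shows "card (W - {0 :: bit ^ 'n}) = 3"
  using assms by (simp add: vertex_card vertex_zero)

text \<open>Every neighbour meets \<open>W\<close> in exactly one nonzero point, so the neighbours
  split according to that point. \<open>W\<close> itself lies on all three of its points and, if it
  has color \<open>j\<close>, must be removed three times.\<close>

lemma neighbour_count:
  fixes W :: "(bit ^ 'n) set"
  assumes W: "W \<in> grassmann_vertices"
  shows "real (card {U \<in> grassmann_vertices. grassmann_adj W U \<and> f U = j}) =
    (\<Sum>w\<in>W - {0}. real (color_count f w j)) - 3 * of_bool (f W = j)"
proof -
  define L where "L = (\<lambda>w. {U \<in> lines_through w. f U = j} - {W})"
  have "{U \<in> grassmann_vertices. grassmann_adj W U \<and> f U = j} = (\<Union>w\<in>W - {0}. L w)"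
    by (auto simp: L_def lines_through_def grassmann_adj_iff[OF W])
  moreover have "card (\<Union>w\<in>W - {0}. L w) = (\<Sum>w\<in>W - {0}. card (L w))"
  proof (rule card_UN_disjoint)
    show "\<forall>w\<in>W - {0}. \<forall>x\<in>W - {0}. w \<noteq> x \<longrightarrow> L w \<inter> L x = {}"
    proof (intro ballI impI)
      fix w x assume wx: "w \<in> W - {0}" "x \<in> W - {0}" "w \<noteq> x"
      have "U = W" if "U \<in> grassmann_vertices" "w \<in> U" "x \<in> U" for U
        by (rule vertex_unique[of _ _ w x]) (use that wx W in auto)
      then show "L w \<inter> L x = {}"
        unfolding L_def lines_through_def by blast
    qed
  qed auto
  moreover have "real (card (L w)) = real (color_count f w j) - of_bool (f W = j)"
    if "w \<in> W - {0}" for w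
  proof (cases "f W = j")
    case True
    then have "W \<in> {U \<in> lines_through w. f U = j}"
      using that W by (simp add: lines_through_def)
    then have "card {U \<in> lines_through w. f U = j} = Suc (card (L w))"
      unfolding L_def by (intro card.remove) auto
    then show ?thesis
      using True by (simp add: color_count_def)
  qed (auto simp: L_def color_count_def)
  ultimately show ?thesis
    by (simp add: sum_subtractf card_vertex_Diff_zero[OF W])
qed

text \<open>Row \<open>\<beta>\<close> counts the lines of colors 1 to 4 through a nonzero point \<open>w\<close> with \<open>b w = \<beta>\<close>, that is,
  the unordered pairs \<open>{x, x + w}\<close> by \<open>1 + \<beta> + b x + b (x + w)\<close>, without the pair \<open>{0, w}\<close>.\<close>

definition point_row :: "nat \<Rightarrow> nat \<Rightarrow> nat \<Rightarrow> real" where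
  "point_row n \<beta> j =
     (if \<beta> = 0
      then [2 ^ n / 8 - 2 ^ (n div 2) / 4, 2 ^ n / 4 - 1, 2 ^ n / 8 + 2 ^ (n div 2) / 4, 0]
      else [0, 2 ^ n / 8 - 2 ^ (n div 2) / 4, 2 ^ n / 4, 2 ^ n / 8 + 2 ^ (n div 2) / 4 - 1])
     ! (j - 1)"

text \<open>The coefficients reflect that, with \<open>b 0 = 1\<close>, a line of color
  \<open>i\<close> has \<open>i - 1\<close> nonzero points of value 1 and \<open>4 - i\<close> of
  value 0.\<close>

lemma quotient_matrix_eq:
  assumes "i \<in> {1, 2, 3, 4}" "j \<in> {1, 2, 3, 4}"
  shows "quotient_matrix n i j =
    (4 - real i) * point_row n 0 j + (real i - 1) * point_row n 1 j - 3 * of_bool (i = j)"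
proof -
  \<comment> \<open>Writing powers as quotients also covers negative exponents, which occur for n =
    2.\<close>
  have "(2::real) powi (int m - int k) = 2 ^ m / 2 ^ k" for m k
    by (simp add: power_int_diff)
  from this[of _ 1] this[of _ 2] this[of _ 3]
  have "(2::real) powi (int m - 1) = 2 ^ m / 2" "(2::real) powi (int m - 2) = 2 ^ m / 4"
    "(2::real) powi (int m - 3) = 2 ^ m / 8" for m
    by simp_all
  note powi = this
  show ?thesis
    unfolding quotient_matrix_def point_row_def Let_def powi
    using assms by (auto simp: field_simps)
qed

text \<open>The correction -3 on the diagonal of the matrix cancels the one in
  \<open>neighbour_count\<close>, leaving a condition on sums over the points of a line.\<close>

lemma perfect_coloring_iff:
  fixes f :: "(bit ^ 'n) set \<Rightarrow> nat"
  assumes f: "f \<in> grassmann_vertices \<rightarrow>\<^sub>E {1, 2, 3, 4}"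
  shows "f \<in> coloring_class \<longleftrightarrow>
    (\<forall>W\<in>grassmann_vertices. \<forall>j\<in>{1, 2, 3, 4}. (\<Sum>w\<in>W - {0}. real (color_count f w j)) =
      (4 - real (f W)) * point_row CARD('n) 0 j + (real (f W) - 1) * point_row CARD('n) 1 j)"
proof -
  have step: "real (card {U \<in> grassmann_vertices. grassmann_adj W U \<and> f U = j}) =
      quotient_matrix CARD('n) (f W) j \<longleftrightarrow>
    (\<Sum>w\<in>W - {0}. real (color_count f w j)) =
      (4 - real (f W)) * point_row CARD('n) 0 j + (real (f W) - 1) * point_row CARD('n) 1 j"
    if "W \<in> grassmann_vertices" "j \<in> {1, 2, 3, 4}" for W j
  proof -
    have "f W \<in> {1, 2, 3, 4}"
      by (rule PiE_mem[OF f that(1)])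
    then show ?thesis
      using that by (simp add: neighbour_count quotient_matrix_eq)
  qed
  have "f \<in> coloring_class \<longleftrightarrow> (\<forall>W\<in>grassmann_vertices. \<forall>j\<in>{1, 2, 3, 4}.
      real (card {U \<in> grassmann_vertices. grassmann_adj W U \<and> f U = j}) =
      quotient_matrix CARD('n) (f W) j)"
    unfolding coloring_class_def perfect_coloring_def mem_Collect_eq
    by (rule iffI[OF conjunct2 conjI[OF f]])
  also have "\<dots> \<longleftrightarrow> (\<forall>W\<in>grassmann_vertices. \<forall>j\<in>{1, 2, 3, 4}.
      (\<Sum>w\<in>W - {0}. real (color_count f w j)) =
      (4 - real (f W)) * point_row CARD('n) 0 j + (real (f W) - 1) * point_row CARD('n) 1 j)"
    by (intro ball_cong refl step)
  finally show ?thesis .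
qed

section \<open>Autocorrelation and lines through a point\<close>

text \<open>For nonzero \<open>w\<close> each unordered pair \<open>{x, x + w}\<close> is counted
  twice, once from either end.\<close>

definition pair_count :: "(bit ^ 'n \<Rightarrow> nat) \<Rightarrow> bit ^ 'n \<Rightarrow> nat \<Rightarrow> nat" where
  "pair_count b w t = card {x. b x + b (x + w) = t}"

lemma bent_coloring_eq_sum:
  assumes "W \<in> grassmann_vertices" and b: "\<And>x :: bit ^ 'n. b x \<in> {0, 1}" and "b 0 = 1"
  shows "bent_coloring b W = 1 + (\<Sum>x\<in>W - {0}. b x)"
proof -
  have "(\<Sum>x\<in>W. b x) = (\<Sum>x\<in>W. of_bool (b x = 1))"
    using b by (intro sum.cong) force+
  also have "\<dots> = bent_coloring b W"
    using assms(1) by (simp add: bent_coloring_def Int_def)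
  finally show ?thesis
    using sum.remove[of W 0 b] vertex_zero[OF assms(1)] \<open>b 0 = 1\<close> by simp
qed

lemma line_Diff_zero:
  "w \<noteq> 0 \<Longrightarrow> x \<noteq> 0 \<Longrightarrow> x \<noteq> w \<Longrightarrow> line w (x :: bit ^ 'n) - {0} = {w, x, x + w}"
  by (auto simp: line_def)

lemma bent_coloring_line:
  assumes "\<And>x :: bit ^ 'n. b x \<in> {0, 1}" "b 0 = 1" "w \<noteq> 0" "x \<noteq> 0" "x \<noteq> w"
  shows "bent_coloring b (line w x) = 1 + b w + (b x + b (x + w))"
  using assms line_in_vertices[of w x]
  by (simp add: bent_coloring_eq_sum line_Diff_zero del: One_nat_def)

text \<open>For \<open>x\<close> outside \<open>{0, w}\<close> the pair sum is \<open>t\<close> iff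
  \<open>line w x\<close> has color \<open>1 + b w + t\<close>, and each line arises from two such
  \<open>x\<close>. The points 0 and \<open>w\<close> both have pair sum \<open>1 + b w\<close>,
  which gives the last term.\<close>

lemma pair_count_eq:
  fixes w :: "bit ^ 'n"
  assumes b: "\<And>x. b x \<in> {0, 1}" "b 0 = 1" and w: "w \<noteq> 0"
  shows "pair_count b w t =
    2 * color_count (bent_coloring b) w (1 + b w + t) + 2 * of_bool (t = 1 + b w)"
proof -
  have "2 * color_count (bent_coloring b) w (1 + b w + t) =
      2 * (\<Sum>W\<in>lines_through w. of_bool (bent_coloring b W = 1 + b w + t))"
    by (simp add: color_count_def Int_def)
  also have "\<dots> = (\<Sum>x\<in>UNIV - {0, w}. of_bool (bent_coloring b (line w x) = 1 + b w + t))"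
    by (rule sum_lines_through[OF w, symmetric])
  also have "\<dots> = (\<Sum>x\<in>UNIV - {0, w}. of_bool (b x + b (x + w) = t))"
    using b w by (intro sum.cong refl) (simp add: bent_coloring_line)
  finally have outside: "2 * color_count (bent_coloring b) w (1 + b w + t) =
      (\<Sum>x\<in>UNIV - {0, w}. of_bool (b x + b (x + w) = t))" .
  have inside: "(2 :: nat) * of_bool (t = 1 + b w) = (\<Sum>x\<in>{0, w}. of_bool (b x + b (x + w) = t))"
    using b w by auto
  have "pair_count b w t = (\<Sum>x\<in>UNIV. of_bool (b x + b (x + w) = t))"
    by (simp add: pair_count_def)
  then show ?thesis
    unfolding outside inside by (subst (asm) sum.subset_diff[of "{0, w}" UNIV]) auto
qed

text \<open>Pair sums are 0, 1 or 2. Choosing \<open>\<phi>\<close> as the constant 1, the identity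
  and the sign yields the three relations of \<open>pair_count_sums\<close>.\<close>

lemma sum_pairs:
  fixes w :: "bit ^ 'n" and \<phi> :: "nat \<Rightarrow> 'a :: comm_semiring_1"
  assumes b: "\<And>x. b x \<in> {0, 1}"
  shows "(\<Sum>x\<in>UNIV. \<phi> (b x + b (x + w))) =
    of_nat (pair_count b w 0) * \<phi> 0 + of_nat (pair_count b w 1) * \<phi> 1 +
    of_nat (pair_count b w 2) * \<phi> 2"
proof -
  have "\<phi> (b x + b (x + w)) = of_bool (b x + b (x + w) = 0) * \<phi> 0 +
      of_bool (b x + b (x + w) = 1) * \<phi> 1 + of_bool (b x + b (x + w) = 2) * \<phi> 2" for x
    using b[of x] b[of "x + w"] by (auto simp: numeral_2_eq_2)
  then have "(\<Sum>x\<in>UNIV. \<phi> (b x + b (x + w))) =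
      (\<Sum>x\<in>UNIV. of_bool (b x + b (x + w) = 0) * \<phi> 0 +
      of_bool (b x + b (x + w) = 1) * \<phi> 1 + of_bool (b x + b (x + w) = 2) * \<phi> 2)"
    by (intro sum.cong) auto
  then show ?thesis
    by (simp only: sum.distrib flip: sum_distrib_right) (simp add: pair_count_def)
qed

lemma sum_shift:
  fixes w :: "bit ^ 'n"
  shows "(\<Sum>x\<in>UNIV. h (x + w)) = (\<Sum>x\<in>UNIV. h x)"
  by (rule sum.reindex_bij_betw) (rule bij_betwI[where g = "\<lambda>x. x + w"], auto)

lemma pair_count_sums:
  fixes w :: "bit ^ 'n"
  assumes b: "\<And>x. b x \<in> {0, 1}"
  shows "real (pair_count b w 0) + real (pair_count b w 1) + real (pair_count b w 2) = 2 ^ CARD('n)"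
    and "real (pair_count b w 1) + 2 * real (pair_count b w 2) = 2 * real (card {x. b x = 1})"
    and "real_of_int (\<Sum>x\<in>UNIV. (-1) ^ (b x + b (x + w))) =
      real (pair_count b w 0) - real (pair_count b w 1) + real (pair_count b w 2)"
proof -
  show "real (pair_count b w 0) + real (pair_count b w 1) + real (pair_count b w 2) = 2 ^ CARD('n)"
    using sum_pairs[where b = b and w = w and \<phi> = "\<lambda>_. 1 :: real", OF b] by simp
  show "real_of_int (\<Sum>x\<in>UNIV. (-1) ^ (b x + b (x + w))) =
      real (pair_count b w 0) - real (pair_count b w 1) + real (pair_count b w 2)"
    using sum_pairs[where b = b and w = w and \<phi> = "\<lambda>t. (-1) ^ t :: real", OF b] by simp
  have "(\<Sum>x\<in>UNIV. real (b x)) = (\<Sum>x\<in>UNIV. of_bool (b x = 1))"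
    using b by (intro sum.cong) force+
  also have "\<dots> = real (card {x. b x = 1})"
    by simp
  finally have "(\<Sum>x\<in>UNIV. real (b x + b (x + w))) = 2 * real (card {x. b x = 1})"
    using sum_shift[where h = "\<lambda>x. real (b x)" and w = w] by (simp add: sum.distrib)
  then show "real (pair_count b w 1) + 2 * real (pair_count b w 2) = 2 * real (card {x. b x = 1})"
    using sum_pairs[where b = b and w = w and \<phi> = real, OF b] by simp
qed

text \<open>With P = 2^n and Q = 2^(n/2), zero autocorrelation at \<open>w\<close> and weight (P +
  Q)/2 together with \<open>pair_count_sums\<close> force the pair counts P/4 - Q/2, P/2, P/4 + Q/2.
  By \<open>pair_count_eq\<close> these are exactly the rows of \<open>point_row\<close>, and the
  argument reverses.\<close>

lemma bent_class_iff:
  fixes b :: "bit ^ 'n \<Rightarrow> nat"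
  assumes b: "\<And>x. b x \<in> {0, 1}" "b 0 = 1" and n: "CARD('n) > 0" "even CARD('n)"
  shows "b \<in> bent_class \<longleftrightarrow> (\<forall>w. w \<noteq> 0 \<longrightarrow> (\<forall>j\<in>{1, 2, 3, 4}.
    real (color_count (bent_coloring b) w j) = point_row CARD('n) (b w) j))"
proof -
  define P Q :: real where "P = 2 ^ CARD('n)" and "Q = 2 ^ (CARD('n) div 2)"
  define c where "c = color_count (bent_coloring b)"
  define K where "K = card {x. b x = 1}"
  have row: "point_row CARD('n) 0 j = [P / 8 - Q / 4, P / 4 - 1, P / 8 + Q / 4, 0] ! (j - 1)"
    "point_row CARD('n) 1 j = [0, P / 8 - Q / 4, P / 4, P / 8 + Q / 4 - 1] ! (j - 1)" for j
    by (simp_all add: point_row_def P_def Q_def)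
  have all_colors: "(\<forall>j\<in>{1, 2, 3, 4 :: nat}. real (c w j) = [p1, p2, p3, p4] ! (j - 1)) \<longleftrightarrow>
      real (c w 1) = p1 \<and> real (c w 2) = p2 \<and> real (c w 3) = p3 \<and> real (c w 4) = p4"
    for w p1 p2 p3 p4
    by simp
  \<comment> \<open>Rules out truncation in the exponent \<open>CARD('n) div 2 - 1\<close>.\<close>
  have "m div 2 > 0" if "m > 0" "even m" for m :: nat
    using that by presburger
  from this[OF n] have "CARD('n) div 2 > 0" .
  moreover have "(2::real) ^ (m - 1) = 2 ^ m / 2" if "m > 0" for m
    using that by (simp add: power_diff)
  ultimately have "real (2 ^ (CARD('n) - 1) + 2 ^ (CARD('n) div 2 - 1)) = P / 2 + Q / 2"
    using n by (simp only: P_def Q_def of_nat_add of_nat_power of_nat_numeral)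
  then have K_iff: "K = 2 ^ (CARD('n) - 1) + 2 ^ (CARD('n) div 2 - 1) \<longleftrightarrow> real K = P / 2 + Q / 2"
    by (metis of_nat_eq_iff)
  have bent_iff: "boolean_bent b \<longleftrightarrow> (\<forall>w. w \<noteq> 0 \<longrightarrow>
      real (pair_count b w 0) - real (pair_count b w 1) + real (pair_count b w 2) = 0)"
  proof -
    have "boolean_bent b \<longleftrightarrow>
        (\<forall>w. w \<noteq> 0 \<longrightarrow> real_of_int (\<Sum>x\<in>UNIV. (-1) ^ (b x + b (x + w))) = 0)"
      using b unfolding boolean_bent_def of_int_eq_0_iff by blast
    then show ?thesis
      unfolding pair_count_sums(3)[where b = b, OF b(1)] .
  qed
  have local_iff: "(\<forall>j\<in>{1, 2, 3, 4}. real (c w j) = point_row CARD('n) (b w) j) \<longleftrightarrow>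
      real (pair_count b w 0) - real (pair_count b w 1) + real (pair_count b w 2) = 0 \<and>
      real K = P / 2 + Q / 2" if w: "w \<noteq> 0" for w
  proof -
    note sums = pair_count_sums(1,2)[where b = b and w = w, OF b(1), folded P_def K_def]
    note pc = pair_count_eq[where b = b, OF b w, folded c_def]
    consider "b w = 0" | "b w = 1"
      using b(1)[of w] by auto
    then show ?thesis
    proof cases
      case 1
      \<comment> \<open>Color 4 corresponds to pair sum 3 here, which two values in
        \<open>{0, 1}\<close> cannot reach.\<close>
      have "pair_count b w 3 = 0"
      proof -
        have "b x + b (x + w) \<noteq> 3" for x
          using b(1)[of x] b(1)[of "x + w"] by auto
        then show ?thesis
          by (simp add: pair_count_def)
      qed
      then have "real (c w 4) = 0"
        using pc[of 3] 1 by simp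
      moreover have "real (pair_count b w 0) = 2 * real (c w 1)"
        "real (pair_count b w 1) = 2 * real (c w 2) + 2" "real (pair_count b w 2) = 2 * real (c w 3)"
        using pc[of 0] pc[of 1] pc[of 2] 1 by (simp_all add: numeral_2_eq_2 numeral_3_eq_3)
      ultimately show ?thesis
        using sums unfolding 1 row all_colors by (intro iffI conjI; elim conjE; linarith)
    next
      case 2
      \<comment> \<open>Color 1 would correspond to pair sum -1, outside the reach of
        \<open>pair_count_eq\<close>; instead, 0 and \<open>w\<close> already give every line
        through \<open>w\<close> color at least 2.\<close>
      have "real (c w 1) = 0"
      proof -
        have "bent_coloring b W \<noteq> 1" if "W \<in> lines_through w" for W
        proof -
          have "W \<in> grassmann_vertices" "w \<in> W - {0}"
            using that w by (auto simp: lines_through_def)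
          moreover from this have "b w \<le> (\<Sum>x\<in>W - {0}. b x)"
            by (intro member_le_sum) auto
          ultimately show ?thesis
            using 2 bent_coloring_eq_sum[where b = b, OF _ b, of W] by linarith
        qed
        then show ?thesis
          by (simp add: c_def color_count_def)
      qed
      moreover have "real (pair_count b w 0) = 2 * real (c w 2)"
        "real (pair_count b w 1) = 2 * real (c w 3)" "real (pair_count b w 2) = 2 * real (c w 4) + 2"
        using pc[of 0] pc[of 1] pc[of 2] 2 by (simp_all add: eval_nat_numeral)
      ultimately show ?thesis
        using sums unfolding 2 row all_colors by (intro iffI conjI; elim conjE; linarith)
    qed
  qed
  \<comment> \<open>The weight condition does not mention \<open>w\<close>; recovering it from the
    local conditions takes at least one nonzero point.\<close>
  have "\<exists>w :: bit ^ 'n. w \<noteq> 0"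
    by (intro exI[of _ 1]) simp
  then show ?thesis
    unfolding bent_class_def mem_Collect_eq bent_iff K_def[symmetric] K_iff c_def[symmetric]
    using local_iff b by blast
qed

section \<open>The correspondence\<close>

lemma bent_coloring_in_PiE:
  assumes b: "\<And>x :: bit ^ 'n. b x \<in> {0, 1}" "b 0 = 1"
  shows "bent_coloring b \<in> grassmann_vertices \<rightarrow>\<^sub>E {1, 2, 3, 4}"
proof (rule PiE_I)
  fix W :: "(bit ^ 'n) set" assume W: "W \<in> grassmann_vertices"
  have "(\<Sum>x\<in>W - {0}. b x) \<le> (\<Sum>x\<in>W - {0}. 1)"
  proof (rule sum_mono)
    fix x show "b x \<le> 1"
      using b(1)[of x] by auto
  qed
  also have "\<dots> = 3"
    using W by (simp add: card_vertex_Diff_zero)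
  finally have le: "(\<Sum>x\<in>W - {0}. b x) \<le> 3" .
  have colors: "1 + m \<in> {1, 2, 3, 4}" if "m \<le> 3" for m :: nat
    using that by (simp, presburger)
  show "bent_coloring b W \<in> {1, 2, 3, 4}"
    unfolding bent_coloring_eq_sum[where b = b, OF W b] by (rule colors[OF le])
qed (simp add: bent_coloring_def)

lemma bent_coloring_perfect:
  fixes b :: "bit ^ 'n \<Rightarrow> nat"
  assumes n: "CARD('n) > 0" "even CARD('n)" and "b \<in> bent_class"
  shows "bent_coloring b \<in> coloring_class"
proof -
  have b: "b x \<in> {0, 1}" "b 0 = 1" for x
    using assms(3) by (auto simp: bent_class_def boolean_bent_def)
  let ?row = "point_row CARD('n)"
  have local: "real (color_count (bent_coloring b) w j) = ?row (b w) j"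
    if "w \<noteq> 0" "j \<in> {1, 2, 3, 4}" for w j
    using bent_class_iff[where b = b, OF b n] assms(3) that by blast
  have "(\<Sum>w\<in>W - {0}. real (color_count (bent_coloring b) w j)) =
      (4 - real (bent_coloring b W)) * ?row 0 j + (real (bent_coloring b W) - 1) * ?row 1 j"
    if W: "W \<in> grassmann_vertices" and j: "j \<in> {1, 2, 3, 4}" for W j
  proof -
    \<comment> \<open>The local counts are affine in \<open>b w\<close>, so their sum over a line
      depends only on its number of ones, that is, on its color.\<close>
    have "(\<Sum>w\<in>W - {0}. real (color_count (bent_coloring b) w j)) =
        (\<Sum>w\<in>W - {0}. ?row 0 j + real (b w) * (?row 1 j - ?row 0 j))"
    proof (intro sum.cong refl)
      fix w assume "w \<in> W - {0}"
      then show "real (color_count (bent_coloring b) w j) = ?row 0 j + real (b w) * (?row 1 j - ?row 0 j)"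
        using local[of w j] j b(1)[of w] by auto
    qed
    also have "\<dots> = 3 * ?row 0 j + real (\<Sum>w\<in>W - {0}. b w) * (?row 1 j - ?row 0 j)"
      using W by (simp add: sum.distrib card_vertex_Diff_zero flip: sum_distrib_right)
    also have "real (\<Sum>w\<in>W - {0}. b w) = real (bent_coloring b W) - 1"
      by (simp add: bent_coloring_eq_sum[where b = b, OF W b])
    finally show ?thesis
      by (simp add: algebra_simps)
  qed
  then show ?thesis
    using perfect_coloring_iff[OF bent_coloring_in_PiE[where b = b, OF b]] by blast
qed

text \<open>Equal colorings make the difference of the two functions sum to 0 on every line, so
  \<open>line_sum_injective\<close> applies off 0; at 0 both functions are 1.\<close>

lemma inj_on_bent_coloring:
  assumes n: "CARD('n) \<ge> 3"
  shows "inj_on (bent_coloring :: (bit ^ 'n \<Rightarrow> nat) \<Rightarrow> _) bent_class"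
proof (rule inj_onI, rule ext)
  fix b c :: "bit ^ 'n \<Rightarrow> nat" and x
  assume mem: "b \<in> bent_class" "c \<in> bent_class" and eq: "bent_coloring b = bent_coloring c"
  have b: "b x \<in> {0, 1}" "b 0 = 1" and c: "c x \<in> {0, 1}" "c 0 = 1" for x
    using mem by (auto simp: bent_class_def boolean_bent_def)
  have "(\<Sum>w\<in>W - {0}. real (b w) - real (c w)) = 0" if "W \<in> grassmann_vertices" for W
  proof -
    have "(\<Sum>w\<in>W - {0}. b w) = (\<Sum>w\<in>W - {0}. c w)"
      using bent_coloring_eq_sum[where b = b, OF that b] bent_coloring_eq_sum[where b = c, OF that c]
      by (simp add: eq)
    then show ?thesis
      by (simp add: sum_subtractf flip: of_nat_sum)
  qed
  from line_sum_injective[OF n this, of x] show "b x = c x"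
    using b(2) c(2) by (cases "x = 0") auto
qed

lemma coloring_class_obtain_bent:
  fixes f :: "(bit ^ 'n) set \<Rightarrow> nat"
  assumes n: "CARD('n) \<ge> 3" "even CARD('n)" and "f \<in> coloring_class"
  shows "f \<in> bent_coloring ` bent_class"
proof -
  have f: "f \<in> grassmann_vertices \<rightarrow>\<^sub>E {1, 2, 3, 4}"
    using assms(3) by (simp add: coloring_class_def perfect_coloring_def)
  define r0 r1 where "r0 = point_row CARD('n) 0" and "r1 = point_row CARD('n) 1"
  have sums: "(\<Sum>w\<in>W - {0}. real (color_count f w j)) =
      (4 - real (f W)) * r0 j + (real (f W) - 1) * r1 j"
    if "W \<in> grassmann_vertices" "j \<in> {1, 2, 3, 4}" for W j
    using assms(3) that unfolding perfect_coloring_iff[OF f] r0_def r1_def by blast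
  have "r1 1 = 0" "r0 4 = 0"
    by (simp_all add: r0_def r1_def point_row_def)
  have "r0 1 > 0" "r1 4 > 0"
  proof -
    \<comment> \<open>This is the exponent comparison behind 2^n/8 > 2^(n/2)/4.\<close>
    have "m div 2 + 1 < m" if "m \<ge> 3" "even m" for m :: nat
      using that by presburger
    from this[OF n] have "(2::real) ^ (CARD('n) div 2 + 1) < 2 ^ CARD('n)"
      by (rule power_strict_increasing) simp
    then show "r0 1 > 0"
      by (simp add: r0_def point_row_def)
    have "(2::real) ^ 3 \<le> 2 ^ CARD('n)"
      using n(1) by (rule power_increasing) simp
    then have "2 ^ CARD('n) \<ge> (8::real)"
      by simp
    moreover have "(2::real) ^ (CARD('n) div 2) > 0"
      by simp
    ultimately have "0 < (2::real) ^ CARD('n) / 8 + 2 ^ (CARD('n) div 2) / 4 - 1"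
      by linarith
    then show "r1 4 > 0"
      by (simp add: r1_def point_row_def)
  qed
  \<comment> \<open>Solves \<open>count\<close> below for \<open>g\<close> at color 1, where
    \<open>r1\<close> vanishes.\<close>
  define g where "g = (\<lambda>w. 1 - real (color_count f w 1) / r0 1)"
  have sum_g: "(\<Sum>w\<in>W - {0}. g w) = real (f W) - 1" if "W \<in> grassmann_vertices" for W
  proof -
    have "(\<Sum>w\<in>W - {0}. g w) = 3 - (\<Sum>w\<in>W - {0}. real (color_count f w 1)) / r0 1"
      unfolding g_def using that
      by (simp add: sum_subtractf card_vertex_Diff_zero flip: sum_divide_distrib)
    also have "(\<Sum>w\<in>W - {0}. real (color_count f w 1)) = (4 - real (f W)) * r0 1"
      using sums[OF that, of 1] \<open>r1 1 = 0\<close> by simp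
    finally show ?thesis
      using \<open>r0 1 > 0\<close> by simp
  qed
  have count: "real (color_count f w j) = r0 j + g w * (r1 j - r0 j)"
    if "w \<noteq> 0" "j \<in> {1, 2, 3, 4}" for w j
  proof -
    \<comment> \<open>Both sides of the claim have the same sum over every line, so they agree at
      every nonzero point.\<close>
    have "(\<Sum>w\<in>W - {0}. real (color_count f w j) - (r0 j + g w * (r1 j - r0 j))) = 0"
      if W: "W \<in> grassmann_vertices" for W
    proof -
      have "(\<Sum>w\<in>W - {0}. r0 j + g w * (r1 j - r0 j)) = 3 * r0 j + (real (f W) - 1) * (r1 j - r0 j)"
        using W by (simp add: sum.distrib card_vertex_Diff_zero sum_g flip: sum_distrib_right)
      then show ?thesis
        unfolding sum_subtractf sums[OF W \<open>j \<in> {1, 2, 3, 4}\<close>] by (simp add: algebra_simps)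
    qed
    from line_sum_injective[OF n(1) this \<open>w \<noteq> 0\<close>] show ?thesis
      by simp
  qed
  have g_nonneg: "g w \<ge> 0" if "w \<noteq> 0" for w
  proof -
    have "g w * r1 4 = real (color_count f w 4)"
      using count[OF that, of 4] \<open>r0 4 = 0\<close> by simp
    then show ?thesis
      using \<open>r1 4 > 0\<close> by (metis of_nat_0_le_iff zero_le_mult_iff not_less)
  qed
  \<comment> \<open>Off 0, \<open>b\<close> is 0 exactly at the points on a line of color 1; the
    value at 0 is prescribed by \<open>bent_class\<close>.\<close>
  define b where "b = (\<lambda>x. if x = 0 \<or> color_count f x 1 = 0 then 1 else 0 :: nat)"
  have b: "b x \<in> {0, 1}" "b 0 = 1" for x
    by (auto simp: b_def)
  have g: "g w = real (b w)" if w: "w \<noteq> 0" for w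
  proof (cases "color_count f w 1 = 0")
    case True
    then show ?thesis
      by (simp add: g_def b_def)
  next
    case False
    then have "{W \<in> lines_through w. f W = 1} \<noteq> {}"
      by (metis card.empty color_count_def)
    then obtain W where "W \<in> lines_through w" "f W = 1"
      by blast
    then have W: "W \<in> grassmann_vertices" "w \<in> W - {0}" "f W = 1"
      using w by (auto simp: lines_through_def)
    have "(\<Sum>w\<in>W - {0}. g w) = 0"
      using sum_g[OF W(1)] W(3) by simp
    then have "g w = 0"
      using W(2) g_nonneg by (subst (asm) sum_nonneg_eq_0_iff) auto
    then show ?thesis
      using False w by (simp add: b_def)
  qed
  have "bent_coloring b = f"
  proof (rule PiE_ext[OF bent_coloring_in_PiE[where b = b, OF b] f])
    fix W :: "(bit ^ 'n) set" assume W: "W \<in> grassmann_vertices"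
    have "real (\<Sum>w\<in>W - {0}. b w) = (\<Sum>w\<in>W - {0}. g w)"
      by (simp add: g)
    then have "real (bent_coloring b W) = real (f W)"
      unfolding bent_coloring_eq_sum[where b = b, OF W b] sum_g[OF W] by simp
    then show "bent_coloring b W = f W"
      by simp
  qed
  moreover have "b \<in> bent_class"
  proof -
    have "real (color_count f w j) = point_row CARD('n) (b w) j"
      if "w \<noteq> 0" "j \<in> {1, 2, 3, 4}" for w j
      using count[OF that] g[OF that(1)] b(1)[of w] by (auto simp: r0_def r1_def)
    then show ?thesis
      using bent_class_iff[where b = b, OF b _ n(2)] by (simp only: \<open>bent_coloring b = f\<close>) simp
  qed
  ultimately show ?thesis
    by blast
qed

text \<open>Line sums no longer determine a function, so this case is settled directly: the whole
  space is the only vertex, and its color is forced to be 3.\<close>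

lemma coloring_class_obtain_bent_dim2:
  fixes f :: "(bit ^ 'n) set \<Rightarrow> nat"
  assumes n: "CARD('n) = 2" and "f \<in> coloring_class"
  shows "f \<in> bent_coloring ` bent_class"
proof -
  have card: "CARD(bit ^ 'n) = 4"
    using n by simp
  then have "card {0 :: bit ^ 'n} < CARD(bit ^ 'n)"
    by simp
  then have "{0 :: bit ^ 'n} \<noteq> UNIV"
    by (metis less_irrefl)
  then obtain z :: "bit ^ 'n" where z: "z \<noteq> 0"
    by blast
  have only: "W = UNIV" if "W \<in> grassmann_vertices" for W :: "(bit ^ 'n) set"
    using vertex_card[OF that] card by (intro card_subset_eq) auto
  have "card {0, z} < CARD(bit ^ 'n)"
    using card z by simp
  then have "{0, z} \<noteq> UNIV"
    by (metis less_irrefl)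
  then obtain x where x: "x \<noteq> 0" "x \<noteq> z"
    by blast
  have vertices: "grassmann_vertices = {UNIV :: (bit ^ 'n) set}"
  proof (rule equalityI)
    show "grassmann_vertices \<subseteq> {UNIV :: (bit ^ 'n) set}"
      using only by auto
    show "{UNIV :: (bit ^ 'n) set} \<subseteq> grassmann_vertices"
      using line_in_vertices[OF z x] only[OF line_in_vertices[OF z x]] by simp
  qed
  have row: "point_row CARD('n) \<beta> j = of_bool (j = 3)" if "j \<in> {1, 2, 3, 4}" for \<beta> j
    using that by (auto simp: point_row_def n)
  have f: "f \<in> grassmann_vertices \<rightarrow>\<^sub>E {1, 2, 3, 4}"
    using assms(2) by (simp add: coloring_class_def perfect_coloring_def)
  have color: "real (color_count h w j) = of_bool (h UNIV = j)" for h :: "_ \<Rightarrow> nat" and w :: "bit ^ 'n" and j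
  proof -
    have "{W \<in> lines_through w. h W = j} = (if h UNIV = j then {UNIV} else {})"
      by (auto simp: lines_through_def vertices)
    then show ?thesis
      by (simp add: color_count_def)
  qed
  have "f UNIV \<in> {1, 2, 3, 4}"
    by (rule PiE_mem[OF f]) (simp add: vertices)
  moreover have "card (UNIV - {0 :: bit ^ 'n}) = 3"
    by (rule card_vertex_Diff_zero) (simp add: vertices)
  \<comment> \<open>Both point rows equal the indicator of color 3, so the condition reads 3
    [f UNIV = j] = 3 [j = 3].\<close>
  ultimately have "f UNIV = 3"
    using assms(2) unfolding perfect_coloring_iff[OF f] vertices by (auto simp: color row)
  \<comment> \<open>Any nonzero \<open>z\<close> serves as the only zero of \<open>b\<close>, since
    the required weight is 2 + 1 = 3.\<close>
  define b where "b = (\<lambda>x. if x = z then 0 else 1 :: nat)"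
  have b: "b x \<in> {0, 1}" "b 0 = 1" for x
    using z by (auto simp: b_def)
  have "bent_coloring b UNIV = 3"
  proof -
    have "{x. b x = 1} = UNIV - {z}"
      by (auto simp: b_def)
    then show ?thesis
      using card by (simp add: bent_coloring_def vertices)
  qed
  then have "bent_coloring b = f"
    using \<open>f UNIV = 3\<close>
    by (intro PiE_ext[OF bent_coloring_in_PiE[where b = b, OF b] f]) (simp add: vertices)
  moreover have "b \<in> bent_class"
    using bent_class_iff[where b = b, OF b] row n \<open>bent_coloring b UNIV = 3\<close> by (simp add: color)
  ultimately show ?thesis
    by blast
qed

(* For CARD('n) = 2 the graph has a single vertex and the class of bent functions has three
   elements, all inducing the same coloring, so only surjectivity is asserted in that case. *)
theorem theorem2:
  assumes "CARD('n::finite) > 0" and "even CARD('n)"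
  shows "(bent_coloring :: (bit ^ 'n \<Rightarrow> nat) \<Rightarrow> _) ` bent_class = coloring_class \<and>
         (CARD('n) \<noteq> 2 \<longrightarrow>
           bij_betw (bent_coloring :: (bit ^ 'n \<Rightarrow> nat) \<Rightarrow> _) bent_class coloring_class)"
proof -
  have dim: "CARD('n) \<ge> 3" if "CARD('n) \<noteq> 2"
  proof -
    have "m \<ge> 3" if "m > 0" "even m" "m \<noteq> 2" for m :: nat
      using that by presburger
    then show ?thesis
      using assms that by blast
  qed
  have "(bent_coloring :: (bit ^ 'n \<Rightarrow> nat) \<Rightarrow> _) ` bent_class = coloring_class"
  proof (intro equalityI subsetI)
    fix f :: "(bit ^ 'n) set \<Rightarrow> nat"
    assume "f \<in> bent_coloring ` bent_class"
    then show "f \<in> coloring_class"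
      using bent_coloring_perfect[OF assms] by blast
  next
    fix f :: "(bit ^ 'n) set \<Rightarrow> nat"
    assume "f \<in> coloring_class"
    then show "f \<in> bent_coloring ` bent_class"
      using coloring_class_obtain_bent coloring_class_obtain_bent_dim2 dim assms(2) by blast
  qed
  then show ?thesis
    using inj_on_bent_coloring dim by (auto simp: bij_betw_def)
qed

end
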